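(* Let $m$ be a positive integer and let $G$ be a graph on $n$ vertices containing no induced subgraph isomorphic to $K_{1,m+1}$. Let $(x,y)$ be an $\left(\frac{m-1}{m}\right)$-max edge of $G$ with $d=\deg(x)\ge\deg(y)=e$. Then \[\operatorname{pd}(G)\le n\left(1-\frac{1}{d+\frac{m-1}{m}e+1}\right).\]
   Context: All graphs are finite and simple. For a scalar $\alpha>0$, an edge $(x,y)$ of $G$ (with its endpoints listed in this order) is called $\alpha$-max if it maximizes the quantity $\deg(x)+\alpha\deg(y)$ over all edges of $G$ and both orderings of their endpoints. $K_{1,m+1}$ is the complete bipartite graph with one vertex on one side and $m+1$ on the other. For $G$ with vertex set $\{x_1,\dots,x_n\}$ and a fixed field $\mathbf{k}$, $S=\mathbf{k}[x_1,\dots,x_n]$, $I(G)=(x_ix_j:(x_i,x_j)\in E(G))$ is the edge ideal, and $\operatorname{pd}(G)$ is the projective dimension of $S/I(G)$. *)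

theory Defs
  imports Complex_Main "HOL-Library.Poly_Mapping"
begin

text \<open>The polynomial ring S = k[x_v : v a vertex], with monomials represented as
  finitely supported exponent vectors (finitely supported maps v to nat).\<close>
type_synonym ('v, 'k) mpoly = "('v \<Rightarrow>\<^sub>0 nat) \<Rightarrow>\<^sub>0 'k"

definition Var :: "'v \<Rightarrow> ('v, 'k::field) mpoly" where
  "Var v = Poly_Mapping.single (Poly_Mapping.single v 1) 1"

definition simple_graph :: "('v \<Rightarrow> 'v \<Rightarrow> bool) \<Rightarrow> bool" where
  "simple_graph E \<longleftrightarrow> (\<forall>u v. E u v \<longrightarrow> E v u) \<and> (\<forall>u. \<not> E u u)"

definition deg :: "('v::finite \<Rightarrow> 'v \<Rightarrow> bool) \<Rightarrow> 'v \<Rightarrow> nat" where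
  "deg E v = card {w. E v w}"

definition alpha_max_edge :: "real \<Rightarrow> ('v::finite \<Rightarrow> 'v \<Rightarrow> bool) \<Rightarrow> 'v \<Rightarrow> 'v \<Rightarrow> bool" where
  "alpha_max_edge \<alpha> E x y \<longleftrightarrow> E x y \<and>
     (\<forall>u w. E u w \<longrightarrow> real (deg E u) + \<alpha> * real (deg E w) \<le> real (deg E x) + \<alpha> * real (deg E y))"

definition has_induced_star :: "('v \<Rightarrow> 'v \<Rightarrow> bool) \<Rightarrow> nat \<Rightarrow> bool" where
  "has_induced_star E k \<longleftrightarrow> (\<exists>c L. finite L \<and> card L = k \<and> c \<notin> L \<and> (\<forall>l\<in>L. E c l) \<and>
      (\<forall>a\<in>L. \<forall>b\<in>L. \<not> E a b))"

definition edge_ideal :: "('v::finite \<Rightarrow> 'v \<Rightarrow> bool) \<Rightarrow> ('v, 'k::field) mpoly set" where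
  "edge_ideal E = {(\<Sum>p\<in>{(u,v). E u v}. c p * Var (fst p) * Var (snd p)) | c. True}"

definition free_mod :: "nat \<Rightarrow> (nat \<Rightarrow> ('v, 'k::field) mpoly) set" where
  "free_mod r = {f. \<forall>j\<ge>r. f j = 0}"

definition mat_app :: "nat \<Rightarrow> nat \<Rightarrow> (nat \<Rightarrow> nat \<Rightarrow> ('v, 'k::field) mpoly)
     \<Rightarrow> (nat \<Rightarrow> ('v, 'k) mpoly) \<Rightarrow> (nat \<Rightarrow> ('v, 'k) mpoly)" where
  "mat_app rows cols A f = (\<lambda>i. if i < rows then (\<Sum>j<cols. A i j * f j) else 0)"

text \<open>A finite free resolution of S/I of length p:
  0 \<rightarrow> F_p \<rightarrow> ... \<rightarrow> F_1 \<rightarrow> F_0 = S \<rightarrow> S/I \<rightarrow> 0, with F_i = S^(b i),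
  d_i : F_i \<rightarrow> F_(i-1) given by the matrix M i, F_i = 0 for i > p.\<close>
definition free_resolution ::
  "('v, 'k::field) mpoly set \<Rightarrow> nat \<Rightarrow> (nat \<Rightarrow> nat) \<Rightarrow> (nat \<Rightarrow> nat \<Rightarrow> nat \<Rightarrow> ('v, 'k) mpoly) \<Rightarrow> bool" where
  "free_resolution I p b M \<longleftrightarrow>
     b 0 = 1 \<and> (\<forall>i>p. b i = 0) \<and>
     {mat_app (b 0) (b 1) (M 1) f 0 | f. f \<in> free_mod (b 1)} = I \<and>
     (\<forall>i\<ge>1. {f \<in> free_mod (b i). mat_app (b (i - 1)) (b i) (M i) f = (\<lambda>_. 0)} =
             {mat_app (b i) (b (Suc i)) (M (Suc i)) g | g. g \<in> free_mod (b (Suc i))})"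

definition proj_dim_quot :: "('v, 'k::field) mpoly set \<Rightarrow> nat" where
  "proj_dim_quot I = (LEAST p. \<exists>b M. free_resolution I p b M)"

definition pd_graph :: "('v::finite \<Rightarrow> 'v \<Rightarrow> bool) \<Rightarrow> 'k::field itself \<Rightarrow> nat" where
  "pd_graph E K = proj_dim_quot (edge_ideal E :: ('v, 'k) mpoly set)"

end

theory Submission
  imports Defs
begin

text \<open>
  Write \<open>\<alpha> = (m - 1) / m\<close> and \<open>D = d + \<alpha> e + 1\<close>. For every vertex \<open>y\<close> the edge ideal satisfies
  \<open>pd(G) \<le> max (pd(G - y) + 1) (pd(G - N[y]) + deg y)\<close>. The bound \<open>pd(H) \<le> |H| (1 - 1/D)\<close> follows
  by induction over all induced subgraphs \<open>H\<close>: take a vertex \<open>v\<close> that is not isolated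
  and delete its neighbours one at a time, after which \<open>v\<close> is isolated and can be dropped for free.
  The term coming from \<open>N[y]\<close> for the \<open>i\<close>-th deleted neighbour \<open>y\<close> is harmless as long as
  \<open>i\<close> plus the current degree of \<open>y\<close> is at most \<open>D\<close>. This holds if at most \<open>\<alpha> deg v\<close> of the vertices
  deleted before \<open>y\<close> are not adjacent to \<open>y\<close>. Such an order exists, chosen from the last vertex
  backwards: a set \<open>A\<close> of neighbours of \<open>v\<close> has no independent subset of size \<open>m + 1\<close>, so a maximal
  independent subset dominates \<open>A\<close> with at most \<open>m\<close> closed neighbourhoods, one of which
  contains at least \<open>|A| / m\<close> elements.
\<close>

section \<open>Finite free resolutions of submodules of free modules\<close>

definition vecs :: "nat \<Rightarrow> (nat \<Rightarrow> 'a::zero) set" where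
  "vecs r = {f. \<forall>j\<ge>r. f j = 0}"

text \<open>Vectors and generators are functions on all of \<open>nat\<close>, so modules of every
  rank share one type. The ambient rank reappears only in
  \<open>free_resolution_of_has_res\<close>.\<close>

definition comb :: "nat \<Rightarrow> (nat \<Rightarrow> nat \<Rightarrow> 'a::comm_ring_1) \<Rightarrow> (nat \<Rightarrow> 'a) \<Rightarrow> nat \<Rightarrow> 'a" where
  "comb c a f = (\<lambda>i. \<Sum>j<c. f j * a j i)"

text \<open>The first syzygy module of the generators \<open>a 0, ..., a (c - 1)\<close>.\<close>

definition relations :: "nat \<Rightarrow> (nat \<Rightarrow> nat \<Rightarrow> 'a::comm_ring_1) \<Rightarrow> (nat \<Rightarrow> 'a) set" where
  "relations c a = {f \<in> vecs c. comb c a f = (\<lambda>_. 0)}"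

text \<open>The index counts the free modules needed: \<open>has_res p M\<close> says that \<open>M\<close> has projective
  dimension below \<open>p\<close>, so that index 0 is the zero module.\<close>

primrec has_res :: "nat \<Rightarrow> (nat \<Rightarrow> 'a::comm_ring_1) set \<Rightarrow> bool" where
  "has_res 0 M \<longleftrightarrow> M = {\<lambda>_. 0}"
| "has_res (Suc p) M \<longleftrightarrow> (\<exists>c a. comb c a ` vecs c = M \<and> has_res p (relations c a))"

definition submod :: "(nat \<Rightarrow> 'a::comm_ring_1) set \<Rightarrow> bool" where
  "submod M \<longleftrightarrow> (\<lambda>_. 0) \<in> M \<and> (\<forall>f\<in>M. \<forall>g\<in>M. (\<lambda>i. f i + g i) \<in> M) \<and>
     (\<forall>r. \<forall>f\<in>M. (\<lambda>i. r * f i) \<in> M)"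

text \<open>Linearity is demanded on the whole function space, so that restricting to a submodule
  brings no carrier conditions.\<close>

definition lin :: "((nat \<Rightarrow> 'a::comm_ring_1) \<Rightarrow> nat \<Rightarrow> 'a) \<Rightarrow> bool" where
  "lin \<phi> \<longleftrightarrow> (\<forall>f g. \<phi> (\<lambda>i. f i + g i) = (\<lambda>i. \<phi> f i + \<phi> g i)) \<and>
     (\<forall>r f. \<phi> (\<lambda>i. r * f i) = (\<lambda>i. r * \<phi> f i))"

text \<open>Together with \<open>shift\<close> this realises the direct sum of free modules of ranks
  \<open>c\<close> and \<open>d\<close> inside \<open>vecs (c + d)\<close>. The polymorphic entries
  let it join coefficient vectors as well as families of generators.\<close>

definition app :: "nat \<Rightarrow> (nat \<Rightarrow> 'b) \<Rightarrow> (nat \<Rightarrow> 'b) \<Rightarrow> nat \<Rightarrow> 'b" where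
  "app c f g = (\<lambda>j. if j < c then f j else g (j - c))"

definition shift :: "nat \<Rightarrow> (nat \<Rightarrow> 'b) \<Rightarrow> nat \<Rightarrow> 'b" where
  "shift c f = (\<lambda>j. f (j + c))"

lemma comb_Suc: "comb (Suc c) a f = (\<lambda>i. comb c a f i + f c * a c i)"
  by (simp add: comb_def)

lemma comb_cong: "(\<And>j. j < c \<Longrightarrow> a j = a' j) \<Longrightarrow> (\<And>j. j < c \<Longrightarrow> f j = f' j) \<Longrightarrow> comb c a f = comb c a' f'"
  by (auto simp: comb_def)

lemma lin_comb: "lin (comb c a)"
  by (simp add: lin_def comb_def sum.distrib sum_distrib_left algebra_simps)

lemma lin_shift: "lin (shift c)"
  by (simp add: lin_def shift_def)

lemma lin_scale: "lin (\<lambda>f i. z * f i)"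
  by (simp add: lin_def algebra_simps)

lemma lin_zero: "lin \<phi> \<Longrightarrow> \<phi> (\<lambda>_. 0) = (\<lambda>_. 0)"
  unfolding lin_def by (drule conjunct2, drule spec[of _ 0]) simp

lemma lin_of_comb: "lin \<phi> \<Longrightarrow> \<phi> (comb c a f) = comb c (\<lambda>j. \<phi> (a j)) f"
proof (induction c)
  case 0
  then show ?case by (simp add: comb_def lin_zero)
next
  case (Suc c)
  then show ?case by (simp add: comb_Suc lin_def)
qed

lemma submod_comb: "submod M \<Longrightarrow> (\<And>j. j < c \<Longrightarrow> a j \<in> M) \<Longrightarrow> comb c a f \<in> M"
proof (induction c)
  case 0
  then show ?case by (simp add: comb_def submod_def)
next
  case (Suc c)
  then show ?case by (simp add: comb_Suc submod_def)
qed

lemma submod_diff: assumes "submod M" "f \<in> M" "g \<in> M" shows "(\<lambda>i. f i - g i) \<in> M"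
proof -
  have "(\<lambda>i. (-1) * g i) \<in> M" using assms unfolding submod_def by blast
  moreover have "(\<lambda>i. f i + h i) \<in> M" if "h \<in> M" for h
    using assms that unfolding submod_def by blast
  ultimately have "(\<lambda>i. f i + (-1) * g i) \<in> M" by blast
  then show ?thesis by simp
qed

lemma submod_relations: "submod (relations c a)"
  using lin_comb[of c a] lin_zero[OF lin_comb, of c a]
  by (auto simp: submod_def relations_def vecs_def lin_def)

lemma submod_lin_kernel: "submod M \<Longrightarrow> lin \<phi> \<Longrightarrow> submod {f \<in> M. \<phi> f = (\<lambda>_. 0)}"
  by (auto simp: submod_def lin_def lin_zero)

lemma comb_app: "comb (c + d) (app c a b) h = (\<lambda>i. comb c a h i + comb d b (shift c h) i)"
proof (induction d)
  case 0
  then show ?case by (auto simp: comb_def app_def)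
next
  case (Suc d)
  then show ?case by (simp add: comb_Suc fun_eq_iff) (simp add: app_def shift_def algebra_simps)
qed

lemma comb_app_left [simp]: "comb c a (app c f g) = comb c a f"
  by (rule comb_cong) (auto simp: app_def)

lemma shift_app [simp]: "shift c (app c f g) = g"
  by (auto simp: shift_def app_def)

lemma app_in_vecs: "g \<in> vecs d \<Longrightarrow> app c f g \<in> vecs (c + d)"
  by (auto simp: app_def vecs_def)

lemma shift_in_vecs: "h \<in> vecs (c + d) \<Longrightarrow> shift c h \<in> vecs d"
  by (auto simp: shift_def vecs_def)

lemma vecs_shift_zero: "shift c h = (\<lambda>_. 0) \<longleftrightarrow> h \<in> vecs c"
  by (auto simp: shift_def vecs_def fun_eq_iff) (metis le_add_diff_inverse2)

lemma comb_in_image: "comb c a h \<in> comb c a ` vecs c"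
proof
  show "comb c a h = comb c a (app c h (\<lambda>_. 0))" by simp
  show "app c h (\<lambda>_. 0) \<in> vecs c" by (auto simp: app_def vecs_def)
qed

lemma generator_in_image: assumes "j < c" shows "a j \<in> comb c a ` vecs c"
proof -
  have "comb c a (\<lambda>i. if i = j then 1 else 0) = a j"
    using assms by (simp add: comb_def if_distrib[where f="\<lambda>x. x * _"] cong: if_cong)
  then show ?thesis using comb_in_image[of c a "\<lambda>i. if i = j then 1 else 0"] by simp
qed

text \<open>The horseshoe lemma: generators of the kernel and lifts of generators of the image
  together generate \<open>M\<close>. Their relations form an extension of the same kind, now along
  \<open>shift c\<close>, so the induction continues.\<close>

lemma has_res_extension:
  assumes "submod M" "lin \<phi>" "has_res p {f \<in> M. \<phi> f = (\<lambda>_. 0)}" "has_res p (\<phi> ` M)"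
  shows "has_res p M"
  using assms
proof (induction p arbitrary: M \<phi>)
  case 0
  then show ?case by fastforce
next
  case (Suc p)
  from Suc.prems obtain c a where a: "comb c a ` vecs c = {f \<in> M. \<phi> f = (\<lambda>_. 0)}" "has_res p (relations c a)"
    by auto
  from Suc.prems obtain d b where b: "comb d b ` vecs d = \<phi> ` M" "has_res p (relations d b)"
    by auto
  have "\<forall>j. \<exists>u. j < d \<longrightarrow> u \<in> M \<and> \<phi> u = b j"
    using generator_in_image[of _ d b] b(1) by (metis imageE)
  then obtain b' where b': "\<And>j. j < d \<Longrightarrow> b' j \<in> M \<and> \<phi> (b' j) = b j" by metis
  have phib': "\<phi> (comb d b' g) = comb d b g" for g
    unfolding lin_of_comb[OF Suc.prems(2)] by (rule comb_cong) (use b' in auto)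
  have b'M: "comb d b' g \<in> M" for g
    using submod_comb[OF Suc.prems(1)] b' by blast
  have aM: "comb c a h \<in> M" "\<phi> (comb c a h) = (\<lambda>_. 0)" for h
    using comb_in_image[of c a h] a(1) by auto
  define a2 where "a2 = app c a b'"
  \<comment> \<open>The two vectors have equal image, so their difference lies in the kernel, which
    the \<open>a j\<close> generate.\<close>
  have decomp: "\<exists>h\<in>vecs c. f = (\<lambda>i. comb c a h i + comb d b' g i)" 
    if "f \<in> M" "\<phi> f = comb d b g" for f g
  proof -
    have "(\<lambda>i. f i - comb d b' g i) \<in> M" using submod_diff[OF Suc.prems(1) that(1) b'M] .
    moreover have "\<phi> (\<lambda>i. f i - comb d b' g i) = (\<lambda>_. 0)"
    proof -
      have "\<phi> (\<lambda>i. f i + (-1) * comb d b' g i) = (\<lambda>i. \<phi> f i + (-1) * \<phi> (comb d b' g) i)"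
        using Suc.prems(2) unfolding lin_def by metis
      then show ?thesis using that phib' by simp
    qed
    ultimately have "(\<lambda>i. f i - comb d b' g i) \<in> comb c a ` vecs c"
      using a(1) by simp
    then obtain h where h: "h \<in> vecs c" "(\<lambda>i. f i - comb d b' g i) = comb c a h"
      by (elim imageE) simp
    have "f = (\<lambda>i. comb c a h i + comb d b' g i)" unfolding h(2)[symmetric] by simp
    then show ?thesis using h(1) by blast
  qed
  have im: "comb (c + d) a2 ` vecs (c + d) = M"
  proof (intro equalityI subsetI)
    fix f assume "f \<in> comb (c + d) a2 ` vecs (c + d)"
    then show "f \<in> M" using Suc.prems(1) aM b'M by (auto simp: a2_def comb_app submod_def)
  next
    fix f assume f: "f \<in> M"
    then obtain g where g: "g \<in> vecs d" "\<phi> f = comb d b g" using b(1) by (metis imageE imageI)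
    from decomp[OF f g(2)] obtain h where h: "h \<in> vecs c" "f = (\<lambda>i. comb c a h i + comb d b' g i)" by blast
    then have "f = comb (c + d) a2 (app c h g)" by (simp add: a2_def comb_app)
    then show "f \<in> comb (c + d) a2 ` vecs (c + d)" using app_in_vecs[OF g(1)] by blast
  qed
  have k1: "{h \<in> relations (c + d) a2. shift c h = (\<lambda>_. 0)} = relations c a"
    by (auto simp: relations_def vecs_shift_zero a2_def comb_app) (auto simp: vecs_def shift_def comb_def)
  \<comment> \<open>A relation among the \<open>b j\<close> need not hold among their lifts, but the
    lifted combination lies in the kernel and is cancelled by a combination of the
    \<open>a j\<close>.\<close>
  have k2: "shift c ` relations (c + d) a2 = relations d b"
  proof (intro equalityI subsetI)
    fix g assume "g \<in> shift c ` relations (c + d) a2"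
    then obtain h where h: "h \<in> vecs (c + d)" "comb (c + d) a2 h = (\<lambda>_. 0)" "g = shift c h"
      by (auto simp: relations_def)
    have "\<phi> (comb (c + d) a2 h) = (\<lambda>i. \<phi> (comb c a h) i + \<phi> (comb d b' g) i)"
      using Suc.prems(2) h(3) unfolding lin_def a2_def comb_app by metis
    then show "g \<in> relations d b"
      using h shift_in_vecs[OF h(1)] aM phib' lin_zero[OF Suc.prems(2)] by (simp add: relations_def)
  next
    fix g assume g: "g \<in> relations d b"
    from g decomp[of "\<lambda>_. 0" g] obtain h where h: "h \<in> vecs c" "(\<lambda>_. 0) = (\<lambda>i. comb c a h i + comb d b' g i)"
      using Suc.prems(1,2) lin_zero by (auto simp: relations_def submod_def)
    then have "app c h g \<in> relations (c + d) a2"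
      using g by (simp add: relations_def a2_def comb_app app_in_vecs)
    then show "g \<in> shift c ` relations (c + d) a2" by (metis image_eqI shift_app)
  qed
  have "has_res p (relations (c + d) a2)"
    using Suc.IH[of "relations (c + d) a2" "shift c", OF submod_relations lin_shift] k1 k2 a(2) b(2) by simp
  then show ?case using im unfolding has_res.simps by blast
qed

text \<open>This is the exact sequence from the intersection through the direct sum of
  \<open>X\<close> and \<open>Y\<close> onto their sum. The intersection enters through the
  relations, hence with an index lower by one.\<close>

lemma has_res_sum:
  assumes "has_res (Suc p) X" "has_res (Suc p) Y" "has_res p (X \<inter> Y)"
  shows "has_res (Suc p) {\<lambda>i. f i + g i | f g. f \<in> X \<and> g \<in> Y}"
proof -
  from assms obtain c a where a: "comb c a ` vecs c = X" "has_res p (relations c a)" by auto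
  from assms obtain d b where b: "comb d b ` vecs d = Y" "has_res p (relations d b)" by auto
  define a2 where "a2 = app c a b"
  have im: "comb (c + d) a2 ` vecs (c + d) = {\<lambda>i. f i + g i | f g. f \<in> X \<and> g \<in> Y}"
  proof (intro equalityI subsetI)
    fix f assume "f \<in> comb (c + d) a2 ` vecs (c + d)"
    then obtain h where "f = comb (c + d) a2 h" by blast
    then show "f \<in> {\<lambda>i. f i + g i | f g. f \<in> X \<and> g \<in> Y}"
      using comb_in_image[of c a h] comb_in_image[of d b "shift c h"] a(1) b(1)
      unfolding a2_def comb_app by blast
  next
    fix f assume "f \<in> {\<lambda>i. f i + g i | f g. f \<in> X \<and> g \<in> Y}"
    then obtain h g where h: "h \<in> vecs c" "g \<in> vecs d" "f = (\<lambda>i. comb c a h i + comb d b g i)"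
      using a(1) b(1) by blast
    then have "f = comb (c + d) a2 (app c h g)" by (simp add: a2_def comb_app)
    then show "f \<in> comb (c + d) a2 ` vecs (c + d)" using app_in_vecs[OF h(2)] by blast
  qed
  have neg: "comb d b (\<lambda>i. - g i) = (\<lambda>i. - comb d b g i)" for g
    by (simp add: comb_def sum_negf)
  \<comment> \<open>A relation equates a combination of the \<open>a j\<close> with the negative of
    one of the \<open>b j\<close>; the common value runs over the intersection. Where it vanishes,
    the relation splits, so \<open>N\<close> is the direct sum of \<open>relations c a\<close> and
    \<open>relations d b\<close>.\<close>
  define N where "N = {h \<in> relations (c + d) a2. comb c a h = (\<lambda>_. 0)}"
  have "comb c a ` relations (c + d) a2 = X \<inter> Y"
  proof (intro equalityI subsetI)
    fix f assume "f \<in> comb c a ` relations (c + d) a2"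
    then obtain h where h: "comb (c + d) a2 h = (\<lambda>_. 0)" "f = comb c a h" by (auto simp: relations_def)
    then have "f = comb d b (\<lambda>i. - shift c h i)"
      by (auto simp: a2_def comb_app neg fun_eq_iff eq_neg_iff_add_eq_0)
    then show "f \<in> X \<inter> Y"
      using h(2) a(1) b(1) comb_in_image[of c a h] comb_in_image[of d b "\<lambda>i. - shift c h i"] by simp
  next
    fix f assume "f \<in> X \<inter> Y"
    then obtain h g where h: "h \<in> vecs c" "f = comb c a h" "g \<in> vecs d" "f = comb d b g"
      using a(1) b(1) by blast
    moreover from h(3) have "(\<lambda>i. - g i) \<in> vecs d" by (simp add: vecs_def)
    ultimately have "app c h (\<lambda>i. - g i) \<in> relations (c + d) a2"
      by (simp add: relations_def a2_def comb_app neg app_in_vecs)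
    then show "f \<in> comb c a ` relations (c + d) a2" using h(2) by (metis comb_app_left image_eqI)
  qed
  moreover have "has_res p N"
  proof (rule has_res_extension[OF _ lin_shift])
    show "submod N" unfolding N_def by (rule submod_lin_kernel[OF submod_relations lin_comb])
    have "{h \<in> N. shift c h = (\<lambda>_. 0)} = relations c a"
      by (auto simp: N_def relations_def vecs_shift_zero a2_def comb_app)
        (auto simp: vecs_def shift_def comb_def)
    then show "has_res p {h \<in> N. shift c h = (\<lambda>_. 0)}" using a by simp
    have "shift c ` N = relations d b"
    proof (intro equalityI subsetI)
      fix g assume "g \<in> shift c ` N"
      then show "g \<in> relations d b"
        by (auto simp: N_def relations_def a2_def comb_app shift_in_vecs)
    next
      fix g assume g: "g \<in> relations d b"
      have "app c (\<lambda>_. 0) g \<in> N"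
        using g lin_zero[OF lin_comb, of c a] by (simp add: N_def relations_def a2_def comb_app app_in_vecs)
      then show "g \<in> shift c ` N" by (metis image_eqI shift_app)
    qed
    then show "has_res p (shift c ` N)" using b by simp
  qed
  ultimately have "has_res p (relations (c + d) a2)"
    using has_res_extension[OF submod_relations lin_comb[of c a], of p "c + d" a2] assms(3)
    by (simp add: N_def)
  then show ?thesis using im unfolding has_res.simps by blast
qed

lemma has_res_Suc: "has_res p M \<Longrightarrow> has_res (Suc p) M"
proof (induction p arbitrary: M)
  case 0
  then have "comb 0 (\<lambda>_ _. 0) ` vecs 0 = M" "relations 0 (\<lambda>_ _. 0 :: 'a) = {\<lambda>_. 0}"
    by (auto simp: comb_def vecs_def relations_def)
  then show ?case by auto
next
  case (Suc p)
  then show ?case by (metis has_res.simps(2))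
qed

lemma has_res_mono: "has_res p M \<Longrightarrow> p \<le> q \<Longrightarrow> has_res q M"
  by (induction q) (auto simp: le_Suc_eq has_res_Suc simp del: has_res.simps)

text \<open>An injective linear map preserves the relations among the generators, so only the first
  step of the resolution changes.\<close>

lemma has_res_lin_image:
  assumes "has_res p M" "lin \<phi>" "\<And>f. \<phi> f = (\<lambda>_. 0) \<Longrightarrow> f = (\<lambda>_. 0)"
  shows "has_res p (\<phi> ` M)"
proof (cases p)
  case 0
  then show ?thesis using assms lin_zero by auto
next
  case (Suc q)
  then obtain c a where a: "comb c a ` vecs c = M" "has_res q (relations c a)" using assms by auto
  have "comb c (\<lambda>j. \<phi> (a j)) ` vecs c = \<phi> ` M"
    unfolding a(1)[symmetric] image_image lin_of_comb[OF assms(2)] ..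
  moreover have "relations c (\<lambda>j. \<phi> (a j)) = relations c a"
    unfolding relations_def lin_of_comb[OF assms(2), symmetric]
    using assms(3) lin_zero[OF assms(2)] by auto
  ultimately show ?thesis using a(2) unfolding Suc has_res.simps by metis
qed

text \<open>The conclusion is \<open>free_resolution\<close> with \<open>b 0\<close> generalised
  from 1 to \<open>r\<close>, since in the induction the next syzygy module sits in a free module of
  another rank.\<close>

lemma free_resolution_of_has_res:
  fixes N :: "(nat \<Rightarrow> ('v, 'k::field) mpoly) set"
  assumes "has_res p N" "N \<subseteq> free_mod r"
  shows "\<exists>b M. b 0 = r \<and> (\<forall>i>p. b i = 0) \<and>
     {mat_app (b 0) (b 1) (M 1) f | f. f \<in> free_mod (b 1)} = N \<and>
     (\<forall>i\<ge>1. {f \<in> free_mod (b i). mat_app (b (i - 1)) (b i) (M i) f = (\<lambda>_. 0)} =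
             {mat_app (b i) (b (Suc i)) (M (Suc i)) g | g. g \<in> free_mod (b (Suc i))})"
  using assms
proof (induction p arbitrary: N r)
  case 0
  then show ?case
    by (intro exI[of _ "\<lambda>i. if i = 0 then r else 0"] exI[of _ "\<lambda>_ _ _. 0"])
      (auto simp: mat_app_def free_mod_def intro!: exI[of _ "\<lambda>_. 0"])
next
  case (Suc p)
  then obtain c a where a: "comb c a ` vecs c = N" "has_res p (relations c a)" by auto
  have fv: "vecs c = (free_mod c :: (nat \<Rightarrow> ('v, 'k) mpoly) set)" by (simp add: vecs_def free_mod_def)
  have "relations c a \<subseteq> free_mod c" by (auto simp: relations_def fv)
  from Suc.IH[OF a(2) this] obtain b M where bM: "b 0 = c" "\<forall>i>p. b i = 0"
     "{mat_app (b 0) (b 1) (M 1) f | f. f \<in> free_mod (b 1)} = relations c a"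
     "\<forall>i\<ge>1. {f \<in> free_mod (b i). mat_app (b (i - 1)) (b i) (M i) f = (\<lambda>_. 0)} =
             {mat_app (b i) (b (Suc i)) (M (Suc i)) g | g. g \<in> free_mod (b (Suc i))}"
    by (elim exE conjE) (rule that)
  define b' where "b' = case_nat r b"
  \<comment> \<open>The generators become the columns of the first matrix, hence the transposition;
    the matrices of the syzygy module move up by one index.\<close>
  define M' where "M' = (\<lambda>i. if i = 1 then (\<lambda>k j. a j k) else M (i - 1))"
  have app: "mat_app r c (\<lambda>k j. a j k) f = comb c a f" for f
  proof -
    have "comb c a f \<in> free_mod r" using Suc.prems(2) a(1) comb_in_image[of c a f] by blast
    then have "comb c a f i = 0" if "\<not> i < r" for i using that by (simp add: free_mod_def)
    then show ?thesis by (auto simp: mat_app_def comb_def mult.commute)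
  qed
  have "{mat_app (b' 0) (b' 1) (M' 1) f | f. f \<in> free_mod (b' 1)} = N"
    using a(1) by (auto simp: b'_def M'_def bM(1) app fv)
  moreover have "{f \<in> free_mod (b' i). mat_app (b' (i - 1)) (b' i) (M' i) f = (\<lambda>_. 0)} =
             {mat_app (b' i) (b' (Suc i)) (M' (Suc i)) g | g. g \<in> free_mod (b' (Suc i))}" if "i \<ge> 1" for i
  proof (cases "i = 1")
    case True
    then show ?thesis using bM(3) by (simp add: b'_def M'_def bM(1) app relations_def fv)
  next
    case False
    with that have "i = Suc (Suc (i - 2))" by simp
    then obtain j where j: "i = Suc (Suc j)" by blast
    have eqs: "b' (Suc k) = b k" "M' (Suc (Suc k)) = M (Suc k)" for k by (simp_all add: b'_def M'_def)
    have "1 \<le> Suc j" by simp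
    from bM(4)[rule_format, OF this] show ?thesis unfolding j eqs diff_Suc_1 .
  qed
  moreover have "\<forall>i>Suc p. b' i = 0" using bM(2) by (auto simp: b'_def split: nat.split)
  moreover have "b' 0 = r" by (simp add: b'_def)
  ultimately show ?case by (intro exI[of _ b'] exI[of _ M'] conjI allI impI) simp_all
qed

section \<open>Ideals as submodules of the free module of rank one\<close>

interpretation ideal: module "(*) :: 'a::comm_ring_1 \<Rightarrow> 'a \<Rightarrow> 'a"
  by standard (auto simp: algebra_simps)

\<comment> \<open>As a rewrite rule it reassociates products to the left and loops with \<open>mult.assoc\<close>.\<close>
declare ideal.scale_scale [simp del]

lemma ideal_span_times_image: "(*) (z :: 'a::comm_ring_1) ` ideal.span T = ideal.span ((*) z ` T)"
proof (intro equalityI subsetI)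
  fix f assume "f \<in> (*) z ` ideal.span T"
  then obtain g where g: "g \<in> ideal.span T" "f = z * g" by blast
  from g(1) have "z * g \<in> ideal.span ((*) z ` T)"
  proof (induction rule: ideal.span_induct_alt)
    case base
    then show ?case by (simp add: ideal.span_zero)
  next
    case (step c x y)
    have "z * (c * x + y) = c * (z * x) + z * y" by (simp add: algebra_simps)
    moreover have "z * x \<in> ideal.span ((*) z ` T)" using step(1) by (intro ideal.span_base) (rule imageI)
    ultimately show ?case using ideal.span_add[OF ideal.span_scale step(2)] by simp
  qed
  then show "f \<in> ideal.span ((*) z ` T)" using g by simp
next
  fix f assume "f \<in> ideal.span ((*) z ` T)"
  then show "f \<in> (*) z ` ideal.span T"
  proof (induction rule: ideal.span_induct_alt)
    case base
    then show ?case using ideal.span_zero by force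
  next
    case (step c x y)
    then obtain t g where "t \<in> T" "x = z * t" "g \<in> ideal.span T" "y = z * g" by blast
    then have "c * x + y = z * (c * t + g)" by (simp add: algebra_simps)
    moreover have "c * t + g \<in> ideal.span T"
      using ideal.span_add[OF ideal.span_scale[OF ideal.span_base]] \<open>t \<in> T\<close> \<open>g \<in> ideal.span T\<close> .
    ultimately show ?case by blast
  qed
qed

text \<open>In this indexing \<open>ideal_has_res p J\<close> bounds the projective dimension of the quotient by \<open>J\<close>,
  rather than that of \<open>J\<close>, by \<open>p\<close>.\<close>

definition ideal_has_res :: "nat \<Rightarrow> 'a::comm_ring_1 set \<Rightarrow> bool" where
  "ideal_has_res p J \<longleftrightarrow> has_res p {f \<in> vecs 1. f 0 \<in> J}"

lemma ideal_has_res_mono: "ideal_has_res p J \<Longrightarrow> p \<le> q \<Longrightarrow> ideal_has_res q J"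
  unfolding ideal_has_res_def by (rule has_res_mono)

lemma ideal_has_res_zero: "ideal_has_res 0 {0}"
proof -
  have "f = (\<lambda>_. 0)" if "f \<in> vecs 1" "f 0 = 0" for f :: "nat \<Rightarrow> 'a"
    using that by (auto simp: vecs_def fun_eq_iff) (metis One_nat_def Suc_leI neq0_conv)
  then show ?thesis by (auto simp: ideal_has_res_def vecs_def)
qed

lemma ideal_has_res_sum:
  assumes "ideal_has_res (Suc p) A" "ideal_has_res (Suc p) B" "ideal_has_res p (A \<inter> B)"
  shows "ideal_has_res (Suc p) {a + b | a b. a \<in> A \<and> b \<in> B}"
proof -
  let ?e = "\<lambda>J. {f \<in> vecs 1. f 0 \<in> J}"
  have "?e A \<inter> ?e B = ?e (A \<inter> B)" by auto
  then have "has_res (Suc p) {\<lambda>i. f i + g i | f g. f \<in> ?e A \<and> g \<in> ?e B}"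
    using assms has_res_sum[of p "?e A" "?e B"] unfolding ideal_has_res_def by metis
  also have "{\<lambda>i. f i + g i | f g. f \<in> ?e A \<and> g \<in> ?e B} = ?e {a + b | a b. a \<in> A \<and> b \<in> B}"
  proof (intro equalityI subsetI)
    fix h assume "h \<in> {\<lambda>i. f i + g i | f g. f \<in> ?e A \<and> g \<in> ?e B}"
    then obtain f g where "h = (\<lambda>i. f i + g i)" "f \<in> ?e A" "g \<in> ?e B" by blast
    then show "h \<in> ?e {a + b | a b. a \<in> A \<and> b \<in> B}" by (auto simp: vecs_def)
  next
    fix h assume "h \<in> ?e {a + b | a b. a \<in> A \<and> b \<in> B}"
    then obtain a b where h: "h \<in> vecs 1" "h 0 = a + b" "a \<in> A" "b \<in> B" by blast
    define f g :: "nat \<Rightarrow> 'a" where "f = (\<lambda>i. if i = 0 then a else 0)" and "g = (\<lambda>i. if i = 0 then b else 0)"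
    have "h = (\<lambda>i. f i + g i)" "f \<in> ?e A" "g \<in> ?e B"
      using h by (auto simp: f_def g_def vecs_def)
    then show "h \<in> {\<lambda>i. f i + g i | f g. f \<in> ?e A \<and> g \<in> ?e B}" by blast
  qed
  finally show ?thesis by (simp only: ideal_has_res_def)
qed

lemma ideal_has_res_times:
  assumes "ideal_has_res p J" "\<And>f. z * f = 0 \<Longrightarrow> f = 0"
  shows "ideal_has_res p ((*) z ` J)"
proof -
  have "has_res p ((\<lambda>f i. z * f i) ` {f \<in> vecs 1. f 0 \<in> J})"
    using assms by (intro has_res_lin_image lin_scale) (auto simp: ideal_has_res_def fun_eq_iff)
  also have "(\<lambda>f i. z * f i) ` {f \<in> vecs 1. f 0 \<in> J} = {f \<in> vecs 1. f 0 \<in> (*) z ` J}"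
  proof (intro equalityI subsetI)
    fix h assume "h \<in> {f \<in> vecs 1. f 0 \<in> (*) z ` J}"
    then obtain a where h: "h \<in> vecs 1" "h 0 = z * a" "a \<in> J" by blast
    define f :: "nat \<Rightarrow> 'a" where "f = (\<lambda>i. if i = 0 then a else 0)"
    have "h = (\<lambda>i. z * f i)" "f \<in> {f \<in> vecs 1. f 0 \<in> J}"
      using h by (auto simp: f_def vecs_def)
    then show "h \<in> (\<lambda>f i. z * f i) ` {f \<in> vecs 1. f 0 \<in> J}" by blast
  qed (auto simp: vecs_def)
  finally show ?thesis by (simp only: ideal_has_res_def)
qed

text \<open>The index is 1 although the quotient is zero: the unit ideal is itself free of rank one,
  and index 0 admits only the zero ideal.\<close>

lemma ideal_has_res_UNIV: "ideal_has_res 1 UNIV"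
proof -
  define a :: "nat \<Rightarrow> nat \<Rightarrow> 'a" where "a = (\<lambda>_ i. if i = 0 then 1 else 0)"
  have c: "comb 1 a f = f" if "f \<in> vecs 1" for f
    using that by (auto simp: comb_def a_def vecs_def)
  then have "comb 1 a ` vecs 1 = {f \<in> vecs 1. f 0 \<in> UNIV}" by (auto simp: image_iff)
  moreover have "relations 1 a = {\<lambda>_. 0}" using c by (auto simp: relations_def vecs_def)
  ultimately show ?thesis unfolding ideal_has_res_def One_nat_def has_res.simps by blast
qed

section \<open>Division by a variable and regularity\<close>

lemma mpoly_induct [case_names zero single add]:
  fixes f :: "'b \<Rightarrow>\<^sub>0 'c::ab_group_add"
  assumes "P 0" "\<And>m c. P (Poly_Mapping.single m c)" "\<And>f g. P f \<Longrightarrow> P g \<Longrightarrow> P (f + g)"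
  shows "P f"
proof (induction f rule: Poly_Mapping.update_induct)
  case (update f a b)
  have "Poly_Mapping.update a b f = f + Poly_Mapping.single a b"
    using update(1) by (intro poly_mapping_eqI) (auto simp: lookup_update lookup_add lookup_single in_keys_iff)
  then show ?case using assms update by simp
qed (use assms in simp)

text \<open>\<open>var_quot z\<close> discards the monomials not divisible by \<open>Var z\<close> and divides the others by it.\<close>

definition var_quot :: "'v \<Rightarrow> ('v, 'k::field) mpoly \<Rightarrow> ('v, 'k) mpoly" where
  "var_quot z = Poly_Mapping.map_key ((+) (Poly_Mapping.single z 1))"

lemma inj_plus_monom: "inj ((+) (m :: 'v \<Rightarrow>\<^sub>0 nat))"
  by (simp add: inj_def)

lemma lookup_var_quot: "Poly_Mapping.lookup (var_quot z f) m = Poly_Mapping.lookup f (Poly_Mapping.single z 1 + m)"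
  unfolding var_quot_def by (simp add: map_key.rep_eq[OF inj_plus_monom])

lemma var_quot_add: "var_quot z (f + g) = var_quot z f + var_quot z g"
  unfolding var_quot_def by (rule map_key_plus[OF inj_plus_monom])

lemma var_quot_zero [simp]: "var_quot z 0 = 0"
  unfolding var_quot_def by (rule map_key_zero[OF inj_plus_monom])

lemma var_quot_single_plus:
  "var_quot z (Poly_Mapping.single (Poly_Mapping.single z 1 + m) c) = Poly_Mapping.single m c"
  unfolding var_quot_def by (rule map_key_single[OF inj_plus_monom])

lemma var_quot_single_eq_0:
  assumes "Poly_Mapping.lookup m z = 0"
  shows "var_quot z (Poly_Mapping.single m c) = 0"
proof (rule poly_mapping_eqI)
  fix k
  have "m \<noteq> Poly_Mapping.single z 1 + k" using assms by (auto simp: lookup_add)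
  then show "Poly_Mapping.lookup (var_quot z (Poly_Mapping.single m c)) k = Poly_Mapping.lookup 0 k"
    by (simp add: lookup_var_quot lookup_single)
qed

lemma monom_decomp:
  assumes "Poly_Mapping.lookup m z \<noteq> (0::nat)"
  obtains k where "m = Poly_Mapping.single z 1 + k"
proof
  show "m = Poly_Mapping.single z 1 + (m - Poly_Mapping.single z 1)"
    using assms by (intro poly_mapping_eqI) (auto simp: lookup_add lookup_minus lookup_single when_def)
qed

lemma var_quot_Var_times: "var_quot z (Var z * f) = f"
  by (induction f rule: mpoly_induct)
    (simp_all add: distrib_left var_quot_add Var_def mult_single var_quot_single_plus[unfolded One_nat_def])

lemma var_quot_times_Var:
  assumes "u \<noteq> z"
  shows "var_quot z (f * Var u) = var_quot z f * Var u"
proof (induction f rule: mpoly_induct)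
  case (single m c)
  show ?case
  proof (cases "Poly_Mapping.lookup m z = 0")
    case True
    then have "Poly_Mapping.lookup (m + Poly_Mapping.single u 1) z = 0" using assms by (simp add: lookup_add lookup_single)
    then show ?thesis using True by (simp add: Var_def mult_single var_quot_single_eq_0)
  next
    case False
    then obtain k where "m = Poly_Mapping.single z 1 + k" by (rule monom_decomp)
    then show ?thesis using var_quot_single_plus[of z "k + Poly_Mapping.single u 1" c] var_quot_single_plus[of z k c]
      by (simp add: Var_def mult_single add.assoc)
  qed
qed (simp_all add: var_quot_add distrib_right)

lemma Var_times_eq_0: "Var z * f = 0 \<Longrightarrow> f = 0"
  using var_quot_Var_times[of z f] by simp

text \<open>Absence of the variable is expressed as commutation with \<open>var_quot z\<close>, the
  form in which it passes to products and to ideals generated by such elements.\<close>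

definition lacks_var :: "'v \<Rightarrow> ('v, 'k::field) mpoly \<Rightarrow> bool" where
  "lacks_var z b \<longleftrightarrow> (\<forall>c. var_quot z (c * b) = var_quot z c * b)"

lemma lacks_var_Var: "u \<noteq> z \<Longrightarrow> lacks_var z (Var u)"
  by (simp add: lacks_var_def var_quot_times_Var)

lemma lacks_var_times: "lacks_var z f \<Longrightarrow> lacks_var z g \<Longrightarrow> lacks_var z (f * g)"
  by (simp add: lacks_var_def mult.assoc[symmetric])

lemma var_quot_in_span:
  assumes "\<And>b. b \<in> B \<Longrightarrow> lacks_var z b" "f \<in> ideal.span B"
  shows "var_quot z f \<in> ideal.span B"
  using assms(2)
proof (induction rule: ideal.span_induct_alt)
  case base
  then show ?case by (simp add: ideal.span_zero)
next
  case (step c x y)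
  then show ?case using assms(1)[of x]
    by (auto simp: var_quot_add lacks_var_def intro: ideal.span_add ideal.span_scale ideal.span_base)
qed

text \<open>\<open>Var z\<close> is regular modulo \<open>ideal.span B\<close>: if
  \<open>Var z * g\<close> lies in that ideal, then applying \<open>var_quot z\<close> shows that
  \<open>g\<close> does too.\<close>

lemma span_Int_Var_times:
  assumes "\<And>b. b \<in> B \<Longrightarrow> lacks_var z b" "ideal.span B \<subseteq> T"
  shows "ideal.span B \<inter> (*) (Var z) ` T = (*) (Var z) ` ideal.span B"
proof (intro equalityI subsetI)
  fix f assume "f \<in> ideal.span B \<inter> (*) (Var z) ` T"
  then obtain g where g: "f = Var z * g" "f \<in> ideal.span B" by blast
  then have "g \<in> ideal.span B" using var_quot_in_span[OF assms(1) g(2)] by (simp add: var_quot_Var_times)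
  then show "f \<in> (*) (Var z) ` ideal.span B" using g by blast
qed (use assms(2) in \<open>auto intro: ideal.span_scale\<close>)

text \<open>By regularity the ideals of \<open>B\<close> and of \<open>Var z\<close> meet in
  \<open>Var z\<close> times the first, an isomorphic copy of it, so their sum costs one more
  step.\<close>

lemma ideal_has_res_insert_Var:
  assumes "\<And>b. b \<in> B \<Longrightarrow> lacks_var z b" "ideal_has_res p (ideal.span B)"
  shows "ideal_has_res (Suc p) (ideal.span (insert (Var z) B))"
proof -
  have z: "ideal.span {Var z} = (*) (Var z) ` UNIV" by (auto simp: ideal.span_singleton mult.commute)
  have "ideal_has_res 1 (ideal.span {Var z} :: ('a, 'b) mpoly set)"
    unfolding z by (rule ideal_has_res_times[OF ideal_has_res_UNIV Var_times_eq_0])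
  then have Z: "ideal_has_res (Suc p) (ideal.span {Var z} :: ('a, 'b) mpoly set)"
    by (rule ideal_has_res_mono) simp
  have "ideal.span B \<inter> ideal.span {Var z} = (*) (Var z) ` ideal.span B"
    unfolding z by (rule span_Int_Var_times) (use assms(1) in auto)
  then have I: "ideal_has_res p (ideal.span B \<inter> ideal.span {Var z})"
    using ideal_has_res_times[OF assms(2) Var_times_eq_0] by simp
  have "ideal_has_res (Suc p) (ideal.span B)" by (rule ideal_has_res_mono[OF assms(2)]) simp
  from ideal_has_res_sum[OF this Z I]
  show ?thesis unfolding ideal.span_Un[symmetric] by simp
qed

section \<open>Edge ideals of induced subgraphs, all inside one polynomial ring\<close>

definition edge_gens :: "('v \<Rightarrow> 'v \<Rightarrow> bool) \<Rightarrow> 'v set \<Rightarrow> ('v, 'k::field) mpoly set" where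
  "edge_gens E W = {Var u * Var v | u v. u \<in> W \<and> v \<in> W \<and> E u v}"

lemma lacks_var_edge_gens: "z \<notin> W \<Longrightarrow> b \<in> edge_gens E W \<Longrightarrow> lacks_var z b"
  by (auto simp: edge_gens_def intro!: lacks_var_times lacks_var_Var)

lemma ideal_has_res_edge_gens_Un_Var:
  assumes "finite Z" "Z \<inter> W = {}" "ideal_has_res p (ideal.span (edge_gens E W :: ('v, 'k::field) mpoly set))"
  shows "ideal_has_res (p + card Z) (ideal.span (edge_gens E W \<union> Var ` Z :: ('v, 'k) mpoly set))"
  using assms
proof (induction Z rule: finite_induct)
  case (insert z Z)
  have "lacks_var z b" if "b \<in> edge_gens E W \<union> Var ` Z" for b :: "('v, 'k) mpoly"
    using that insert by (auto intro: lacks_var_edge_gens lacks_var_Var)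
  then have "ideal_has_res (Suc (p + card Z)) 
      (ideal.span (insert (Var z) (edge_gens E W \<union> Var ` Z) :: ('v, 'k) mpoly set))"
    using insert by (intro ideal_has_res_insert_Var) auto
  then show ?case using insert by simp
qed simp

text \<open>The step uses \<open>I(W) = I(W - x) + x (N(x) + I(W - N[x]))\<close>, where the two summands meet in
  \<open>x I(W - x)\<close> because \<open>x\<close> is regular modulo \<open>I(W - x)\<close>.\<close>

lemma ideal_has_res_vertex_step:
  assumes E: "simple_graph E" and "finite W" "x \<in> W"
    and del: "ideal_has_res r (ideal.span (edge_gens E (W - {x}) :: ('v, 'k::field) mpoly set))"
    and link: "ideal_has_res q (ideal.span (edge_gens E (W - insert x {v \<in> W. E x v}) :: ('v, 'k) mpoly set))"
    and le: "q + card {v \<in> W. E x v} \<le> Suc r"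
  shows "ideal_has_res (Suc r) (ideal.span (edge_gens E W :: ('v, 'k) mpoly set))"
proof -
  define N where "N = {v \<in> W. E x v}"
  define T :: "('v, 'k) mpoly set" where "T = edge_gens E (W - insert x N) \<union> Var ` N"
  let ?D = "edge_gens E (W - {x}) :: ('v, 'k) mpoly set"
  have sym: "E u v \<Longrightarrow> E v u" for u v using E by (auto simp: simple_graph_def)
  have "ideal_has_res (q + card N) (ideal.span T)"
    unfolding T_def using link assms(2)
    by (intro ideal_has_res_edge_gens_Un_Var) (auto simp: N_def)
  then have "ideal_has_res (Suc r) (ideal.span T)"
    using le ideal_has_res_mono unfolding N_def by blast
  then have link': "ideal_has_res (Suc r) ((*) (Var x) ` ideal.span T)"
    by (rule ideal_has_res_times[OF _ Var_times_eq_0])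
  \<comment> \<open>An edge avoiding \<open>x\<close> either meets \<open>N\<close>, and is a
    multiple of a variable in \<open>T\<close>, or is itself a generator in
    \<open>T\<close>.\<close>
  have "?D \<subseteq> ideal.span T"
  proof
    fix f assume "f \<in> ?D"
    then obtain u v where uv: "f = Var u * Var v" "u \<in> W - {x}" "v \<in> W - {x}" "E u v"
      by (auto simp: edge_gens_def)
    consider "u \<in> N" | "v \<in> N" | "u \<notin> N" "v \<notin> N" by blast
    then show "f \<in> ideal.span T"
    proof cases
      case 1
      then have "Var u \<in> ideal.span T" by (intro ideal.span_base) (simp add: T_def)
      then show ?thesis using ideal.span_scale[of "Var u" T "Var v"] uv by (simp add: mult.commute)
    next
      case 2
      then have "Var v \<in> ideal.span T" by (intro ideal.span_base) (simp add: T_def)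
      then show ?thesis using ideal.span_scale[of "Var v" T "Var u"] uv by simp
    next
      case 3
      then have "f \<in> edge_gens E (W - insert x N)" using uv by (auto simp: edge_gens_def)
      then show ?thesis by (intro ideal.span_base) (simp add: T_def)
    qed
  qed
  then have "ideal.span ?D \<subseteq> ideal.span T" by (simp add: ideal.span_minimal)
  then have "ideal.span ?D \<inter> (*) (Var x) ` ideal.span T = (*) (Var x) ` ideal.span ?D"
    by (intro span_Int_Var_times) (auto intro: lacks_var_edge_gens)
  then have "ideal_has_res r (ideal.span ?D \<inter> (*) (Var x) ` ideal.span T)"
    using ideal_has_res_times[OF del Var_times_eq_0] by simp
  then have "ideal_has_res (Suc r) {a + b | a b. a \<in> ideal.span ?D \<and> b \<in> (*) (Var x) ` ideal.span T}"
    using link' by (intro ideal_has_res_sum ideal_has_res_mono[OF del]) auto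
  moreover have "{a + b | a b. a \<in> ideal.span ?D \<and> b \<in> (*) (Var x) ` ideal.span T} = 
      ideal.span (edge_gens E W)"
    unfolding ideal_span_times_image ideal.span_Un[symmetric] ideal.span_eq
  proof (intro conjI subsetI)
    fix f assume "f \<in> ?D \<union> (*) (Var x) ` T"
    then consider "f \<in> ?D" | v where "v \<in> N" "f = Var x * Var v" 
      | g where "g \<in> edge_gens E (W - insert x N)" "f = Var x * g" unfolding T_def by blast
    then show "f \<in> ideal.span (edge_gens E W)"
    proof cases
      case 1
      then show ?thesis by (intro ideal.span_base) (auto simp: edge_gens_def)
    next
      case 2
      then show ?thesis using assms(3) by (intro ideal.span_base) (auto simp: edge_gens_def N_def)
    next
      case 3
      then have "g \<in> edge_gens E W" by (auto simp: edge_gens_def)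
      then show ?thesis using 3 by (auto intro: ideal.span_scale ideal.span_base)
    qed
  next
    fix f assume "f \<in> (edge_gens E W :: ('v, 'k) mpoly set)"
    then obtain u v where uv: "f = Var u * Var v" "u \<in> W" "v \<in> W" "E u v"
      by (auto simp: edge_gens_def)
    have "f \<in> ?D \<union> (*) (Var x) ` T"
    proof (cases "u = x \<or> v = x")
      case True
      then obtain w where "w \<in> N" "f = Var x * Var w"
        using uv sym by (auto simp: N_def mult.commute)
      then show ?thesis by (auto simp: T_def)
    qed (use uv in \<open>auto simp: edge_gens_def\<close>)
    then show "f \<in> ideal.span (?D \<union> (*) (Var x) ` T)" by (rule ideal.span_base)
  qed
  ultimately show ?thesis by simp
qed

lemma edge_ideal_eq_span: "edge_ideal E = ideal.span (edge_gens E UNIV)"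
proof (intro equalityI subsetI)
  fix f :: "('a, 'b) mpoly" assume "f \<in> edge_ideal E"
  then obtain c where f: "f = (\<Sum>p\<in>{(u,v). E u v}. c p * Var (fst p) * Var (snd p))"
    by (auto simp: edge_ideal_def)
  show "f \<in> ideal.span (edge_gens E UNIV)" unfolding f mult.assoc[of "c _"]
  proof (intro ideal.span_sum ideal.span_scale[of "_ * _"] ideal.span_base)
    fix p assume "p \<in> {(u, v). E u v}"
    then have "E (fst p) (snd p)" by auto
    then show "Var (fst p) * Var (snd p) \<in> edge_gens E UNIV" unfolding edge_gens_def by blast
  qed
next
  fix f :: "('a, 'b) mpoly" assume "f \<in> ideal.span (edge_gens E UNIV)"
  then show "f \<in> edge_ideal E"
  proof (induction rule: ideal.span_induct_alt)
    case base
    then show ?case by (auto simp: edge_ideal_def intro!: exI[of _ "\<lambda>_. 0"])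
  next
    case (step k g f)
    from step(1) obtain u v where g: "g = Var u * Var v" "E u v" unfolding edge_gens_def by blast
    from step(2) obtain c where f: "f = (\<Sum>p\<in>{(u,v). E u v}. c p * Var (fst p) * Var (snd p))"
      unfolding edge_ideal_def by blast
    \<comment> \<open>A multiple of one generator is a sum with coefficients supported at the single
      pair \<open>(u, v)\<close>, so it can be absorbed into \<open>c\<close>.\<close>
    have "(\<Sum>p\<in>{(u,v). E u v}. (if p = (u, v) then k else 0) * Var (fst p) * Var (snd p)) = k * g"
    proof -
      have "(if p = (u, v) then k else 0) * Var (fst p) * Var (snd p) = (if p = (u, v) then k * g else 0)" for p
        unfolding g(1) by (cases "p = (u, v)") (simp_all add: mult.assoc)
      then show ?thesis using g(2) by simp
    qed
    then have "k * g + f = (\<Sum>p\<in>{(u,v). E u v}. ((if p = (u, v) then k else 0) + c p) * Var (fst p) * Var (snd p))"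
      unfolding f by (simp add: distrib_right sum.distrib)
    then show ?case unfolding edge_ideal_def
      by (intro CollectI exI[of _ "\<lambda>p. (if p = (u, v) then k else 0) + c p"] conjI TrueI)
  qed
qed

text \<open>Since \<open>proj_dim_quot\<close> is a least length, exhibiting one resolution
  suffices.\<close>

lemma pd_graph_le:
  fixes E :: "'v::finite \<Rightarrow> 'v \<Rightarrow> bool"
  assumes "ideal_has_res p (ideal.span (edge_gens E UNIV :: ('v, 'k::field) mpoly set))"
  shows "pd_graph E TYPE('k) \<le> p"
proof -
  let ?N = "{f \<in> vecs 1. f 0 \<in> (edge_ideal E :: ('v, 'k) mpoly set)}"
  have "has_res p ?N" "?N \<subseteq> free_mod 1"
    using assms by (auto simp: edge_ideal_eq_span ideal_has_res_def vecs_def free_mod_def)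
  from free_resolution_of_has_res[OF this] obtain b M where bM: "b 0 = 1" "\<forall>i>p. b i = 0"
     "{mat_app (b 0) (b 1) (M 1) f | f. f \<in> free_mod (b 1)} = ?N"
     "\<forall>i\<ge>1. {f \<in> free_mod (b i). mat_app (b (i - 1)) (b i) (M i) f = (\<lambda>_. 0)} =
             {mat_app (b i) (b (Suc i)) (M (Suc i)) g | g. g \<in> free_mod (b (Suc i))}"
    by (elim exE conjE) (rule that)
  have "{mat_app (b 0) (b 1) (M 1) f 0 | f. f \<in> free_mod (b 1)} = (\<lambda>h. h 0) ` ?N"
    unfolding bM(3)[symmetric] by blast
  also have "\<dots> = edge_ideal E"
  proof (intro equalityI subsetI)
    fix f :: "('v, 'k) mpoly" assume "f \<in> edge_ideal E"
    then have "(\<lambda>i. if i = 0 then f else 0) \<in> ?N" by (auto simp: vecs_def)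
    then show "f \<in> (\<lambda>h. h 0) ` ?N" by (rule rev_image_eqI) simp
  qed auto
  finally have "free_resolution (edge_ideal E :: ('v, 'k) mpoly set) p b M"
    unfolding free_resolution_def using bM by (intro conjI) simp_all
  then show ?thesis unfolding pd_graph_def proj_dim_quot_def by (intro Least_le) blast
qed

section \<open>Order of deletion and the numerical bound\<close>

lemma exists_few_nonneighbors:
  fixes E :: "'v \<Rightarrow> 'v \<Rightarrow> bool"
  assumes "finite A" "A \<noteq> {}" "m \<ge> 1" and E: "simple_graph E"
    and indep: "\<forall>L. L \<subseteq> A \<longrightarrow> (\<forall>a\<in>L. \<forall>b\<in>L. \<not> E a b) \<longrightarrow> card L \<le> m"
  shows "\<exists>y\<in>A. real (card {a \<in> A. a \<noteq> y \<and> \<not> E y a}) \<le> (real m - 1) / real m * real (card A)"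
proof -
  have sym: "\<And>u v. E u v \<Longrightarrow> E v u" and irr: "\<And>u. \<not> E u u" using E by (auto simp: simple_graph_def)
  let ?I = "{L. L \<subseteq> A \<and> (\<forall>a\<in>L. \<forall>b\<in>L. \<not> E a b)}"
  have "finite ?I" "?I \<noteq> {}" using assms(1) by auto
  from finite_has_maximal[OF this] obtain L where L: "L \<in> ?I" and max: "\<forall>L'\<in>?I. L \<subseteq> L' \<longrightarrow> L = L'"
    by (elim bexE)
  define C where "C = (\<lambda>y. {a \<in> A. a = y \<or> E y a})"
  have dom: "A \<subseteq> (\<Union>y\<in>L. C y)"
  proof
    fix a assume a: "a \<in> A"
    show "a \<in> (\<Union>y\<in>L. C y)"
    proof (rule ccontr)
      assume n: "a \<notin> (\<Union>y\<in>L. C y)"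
      have nb: "\<not> E y a" if "y \<in> L" for y using n a that by (auto simp: C_def)
      then have nb': "\<not> E a y" if "y \<in> L" for y using sym that by blast
      have "insert a L \<in> ?I" using a L irr nb nb' by simp
      then have "L = insert a L" using max[rule_format, OF _ subset_insertI] by blast
      then show False using n a by (auto simp: C_def)
    qed
  qed
  have finL: "finite L" using L assms(1) finite_subset by blast
  have finC: "finite (C y)" for y using assms(1) by (simp add: C_def)
  have Lm: "card L \<le> m" using indep L by blast
  \<comment> \<open>Pigeonhole, multiplied through by \<open>m\<close> to stay in the natural
    numbers: at most \<open>m\<close> sets \<open>C y\<close> cover \<open>A\<close>.\<close>
  have "\<exists>y\<in>L. card A \<le> m * card (C y)"
  proof (rule ccontr)
    assume "\<not> ?thesis"
    then have lt: "m * card (C y) < card A" if "y \<in> L" for y using that by auto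
    have "L \<noteq> {}" using dom assms(2) by auto
    have "card A \<le> (\<Sum>y\<in>L. card (C y))"
      using card_mono[OF _ dom] card_UN_le[OF finL, of C] finL finC by fastforce
    then have "m * card A \<le> (\<Sum>y\<in>L. m * card (C y))"
      by (simp add: sum_distrib_left[symmetric])
    also have "\<dots> < (\<Sum>y\<in>L. card A)"
      by (rule sum_strict_mono[OF finL \<open>L \<noteq> {}\<close> lt])
    also have "\<dots> \<le> m * card A" using Lm by simp
    finally show False by simp
  qed
  then obtain y where y: "y \<in> L" "card A \<le> m * card (C y)" by blast
  have "A = C y \<union> {a \<in> A. a \<noteq> y \<and> \<not> E y a}" by (auto simp: C_def)
  then have "card A = card (C y \<union> {a \<in> A. a \<noteq> y \<and> \<not> E y a})" by simp
  also have "\<dots> = card (C y) + card {a \<in> A. a \<noteq> y \<and> \<not> E y a}"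
    by (rule card_Un_disjoint) (use assms(1) in \<open>auto simp: C_def\<close>)
  finally have eq: "real (card A) = real (card (C y)) + real (card {a \<in> A. a \<noteq> y \<and> \<not> E y a})"
    by simp
  \<comment> \<open>With at least a fraction \<open>1 / m\<close> of \<open>A\<close> in
    \<open>C y\<close>, at most \<open>1 - 1 / m\<close> of it remains, which is the factor in the
    claim.\<close>
  have "real (card A) \<le> real m * real (card (C y))"
    using y(2) by (metis of_nat_le_iff of_nat_mult)
  then have "real (card {a \<in> A. a \<noteq> y \<and> \<not> E y a}) \<le> (real m - 1) / real m * real (card A)"
    using eq assms(3) by (simp add: field_simps)
  then show ?thesis using y(1) L by blast
qed

lemma edge_gens_remove_isolated:
  assumes "\<And>w. w \<in> W \<Longrightarrow> \<not> E v w" "\<And>w. w \<in> W \<Longrightarrow> \<not> E w v"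
  shows "edge_gens E (W - {v}) = edge_gens E W"
  using assms by (fastforce simp: edge_gens_def)

text \<open>\<open>D\<close> is fixed by degrees in the whole graph. Degrees only drop in induced
  subgraphs, so the same \<open>D\<close> serves for every \<open>W\<close> in the
  induction.\<close>

lemma edge_ideal_res_bound:
  fixes E :: "'v::finite \<Rightarrow> 'v \<Rightarrow> bool" and D :: real
  assumes E: "simple_graph E" and m: "m \<ge> 1" and star: "\<not> has_induced_star E (m + 1)"
    and D1: "D \<ge> 1"
    and D: "\<And>u w. E u w \<Longrightarrow> real (deg E u) + (real m - 1) / real m * real (deg E w) + 1 \<le> D"
  shows "\<exists>p. ideal_has_res p (ideal.span (edge_gens E W :: ('v, 'k::field) mpoly set)) \<and>
           real p \<le> real (card W) * (1 - 1 / D)"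
proof (induction "card W" arbitrary: W rule: less_induct)
  case less
  define t where "t = real (card W) * (1 - 1 / D)"
  define R :: "nat \<Rightarrow> 'v set \<Rightarrow> bool" where
    "R = (\<lambda>p U. ideal_has_res p (ideal.span (edge_gens E U :: ('v, 'k) mpoly set)))"
  let ?\<alpha> = "(real m - 1) / real m"
  have sym: "\<And>u v. E u v \<Longrightarrow> E v u" and irr: "\<And>u. \<not> E u u" using E by (auto simp: simple_graph_def)
  have \<alpha>: "?\<alpha> \<ge> 0" using m by simp
  have IH: "\<exists>p. R p U \<and> real p \<le> real (card U) * (1 - 1 / D)" if "U \<subset> W" for U
    using less[of U] that psubset_card_mono[of W U] unfolding R_def by simp
  show ?case
  proof (cases "\<exists>v\<in>W. \<exists>w\<in>W. E v w")
    case False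
    then have "edge_gens E W = ({} :: ('v, 'k) mpoly set)" by (auto simp: edge_gens_def)
    then have "R 0 W" using ideal_has_res_zero by (simp add: R_def)
    moreover have "t \<ge> 0" using D1 by (simp add: t_def)
    ultimately show ?thesis by (auto simp: R_def t_def intro!: exI[of _ 0])
  next
    case True
    then obtain v where v: "v \<in> W" "\<exists>w\<in>W. E v w" by blast
    define N where "N = {w \<in> W. E v w}"
    \<comment> \<open>Removing \<open>s\<close> vertices lowers the target by
      \<open>s - s / D\<close>, which is at least \<open>s - 1\<close> because \<open>s\<close> is
      at most \<open>D\<close>. So \<open>s - 1\<close> further steps are affordable.\<close>
    have budget: "real p + (s - 1) \<le> t" 
      if "real p \<le> real (card U) * (1 - 1 / D)" "real (card U) = real (card W) - s" "s \<le> D" for p U s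
    proof -
      have "real (card U) * (1 - 1 / D) + (s - 1) = t + (s / D - 1)"
        using D1 unfolding t_def that(2) by (simp add: field_simps)
      moreover have "s / D \<le> 1" using that(3) D1 by simp
      ultimately show ?thesis using that(1) by linarith
    qed
    have kN: "card N \<le> deg E v" unfolding N_def deg_def by (rule card_mono) auto
    \<comment> \<open>Once \<open>N\<close> is gone, \<open>v\<close> is isolated and leaves for
      free: \<open>card N + 1\<close> vertices disappear while only \<open>card N\<close> steps have
      to be paid for.\<close>
    have base: "\<exists>p. R p (W - N) \<and> real p + real (card N) \<le> t"
    proof -
      have vW: "insert v N \<subseteq> W" "v \<notin> N" using v irr by (auto simp: N_def)
      then obtain p where p: "R p (W - insert v N)" "real p \<le> real (card (W - insert v N)) * (1 - 1 / D)"
        using IH[of "W - insert v N"] by blast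
      have "edge_gens E (W - N - {v}) = (edge_gens E (W - N) :: ('v, 'k) mpoly set)"
        by (rule edge_gens_remove_isolated) (use sym in \<open>auto simp: N_def\<close>)
      moreover have "W - N - {v} = W - insert v N" by auto
      ultimately have "R p (W - N)" using p(1) by (simp add: R_def)
      moreover have "card (W - insert v N) = card W - (card N + 1)" "card N + 1 \<le> card W"
        using vW card_mono[OF _ vW(1)] by (simp_all add: card_Diff_subset)
      moreover have "real (card N) + 1 \<le> D"
      proof -
        obtain w where "E v w" using v by blast
        then have "real (deg E v) + 1 \<le> D" using D[of v w] \<alpha> by (smt (verit) mult_nonneg_nonneg of_nat_0_le_iff)
        then show ?thesis using kN by linarith
      qed
      ultimately have "real p + (real (card N) + 1 - 1) \<le> t" by (intro budget[OF p(2)]) auto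
      then show ?thesis using \<open>R p (W - N)\<close> by auto
    qed
    \<comment> \<open>\<open>T A\<close> reserves one step for each vertex of \<open>A\<close> still
      to be put back. The argument descends from \<open>T N\<close> to \<open>T {}\<close>, which is
      the claim.\<close>
    define T where "T = (\<lambda>A. A \<subseteq> N \<and> (\<exists>p. R p (W - A) \<and> real p + real (card A) \<le> t))"
    have step: "\<exists>y\<in>A. T (A - {y})" if A: "T A" "A \<noteq> {}" for A
    proof -
      have AN: "A \<subseteq> N" using A(1) by (simp add: T_def)
      obtain p where p: "R p (W - A)" "real p + real (card A) \<le> t" using A(1) by (auto simp: T_def)
      have "card L \<le> m" if L: "L \<subseteq> A" "\<forall>a\<in>L. \<forall>b\<in>L. \<not> E a b" for L
      proof (rule ccontr)
        assume "\<not> card L \<le> m"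
        then obtain L' where L': "L' \<subseteq> L" "card L' = m + 1"
          by (metis Suc_eq_plus1 not_less_eq_eq obtain_subset_with_card_n)
        have Ev: "\<forall>l\<in>L'. E v l" using L' L AN by (auto simp: N_def)
        moreover have "v \<notin> L'" using Ev irr by blast
        moreover have "\<forall>a\<in>L'. \<forall>b\<in>L'. \<not> E a b" using L(2) L'(1) by blast
        ultimately have "has_induced_star E (m + 1)"
          unfolding has_induced_star_def using L'(2) by (intro exI[of _ v] exI[of _ L'] conjI) simp_all
        then show False using star by simp
      qed
      then have "\<forall>L. L \<subseteq> A \<longrightarrow> (\<forall>a\<in>L. \<forall>b\<in>L. \<not> E a b) \<longrightarrow> card L \<le> m" by simp
      from exists_few_nonneighbors[OF _ A(2) m E this] obtain y where y: "y \<in> A"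
        and few: "real (card {a \<in> A. a \<noteq> y \<and> \<not> E y a}) \<le> ?\<alpha> * real (card A)" by auto
      \<comment> \<open>\<open>U\<close> is \<open>W - A\<close> with \<open>y\<close> put back, so
        deleting \<open>y\<close> leads to the bound given by \<open>T A\<close>, while deleting its
        closed neighbourhood leads to the induction hypothesis.\<close>
      define U where "U = W - (A - {y})"
      define K where "K = {w \<in> U. E y w}"
      have AW: "A \<subseteq> W" using AN by (auto simp: N_def)
      have Ey: "E y v" using y AN unfolding N_def by (blast intro: sym)
      \<comment> \<open>The vertex \<open>v\<close> survives in every \<open>U\<close>; thus
        \<open>card K\<close> is positive and the truncated subtraction in \<open>r\<close> below is
        exact.\<close>
      have "v \<in> K" using Ey v(1) AN irr by (auto simp: K_def U_def N_def)
      then have K1: "card K \<ge> 1" using card_mono[of K "{v}"] by simp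
      have Uy: "U - {y} = W - A" "y \<in> U" using y AW by (auto simp: U_def)
      have rem: "U - insert y K = W - (A \<union> K)" "A \<inter> K = {}" "A \<union> K \<subseteq> W"
        using y AW irr by (auto simp: U_def K_def)
      obtain q where q: "R q (U - insert y K)" "real q \<le> real (card (U - insert y K)) * (1 - 1 / D)"
        using IH[of "U - insert y K"] rem y by blast
      have cU: "real (card (U - insert y K)) = real (card W) - real (card A + card K)"
        using rem card_mono[OF _ rem(3)] by (simp add: card_Diff_subset card_Un_disjoint of_nat_diff)
      \<comment> \<open>The neighbours of \<open>y\<close> in \<open>W\<close> lie either in
        \<open>A\<close> or in \<open>K\<close>. Hence the vertices missing from
        \<open>U - insert y K\<close> are \<open>y\<close>, its non-neighbours in \<open>A\<close>,
        and its neighbours in \<open>W\<close>.\<close>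
      have "card A + card K = 1 + card {a \<in> A. a \<noteq> y \<and> \<not> E y a} + card {w \<in> W. E y w}"
      proof -
        have "A = insert y ({a \<in> A. a \<noteq> y \<and> \<not> E y a} \<union> {a \<in> A. E y a})" using y by auto
        then have "card A = card (insert y ({a \<in> A. a \<noteq> y \<and> \<not> E y a} \<union> {a \<in> A. E y a}))" by simp
        also have "\<dots> = 1 + card ({a \<in> A. a \<noteq> y \<and> \<not> E y a} \<union> {a \<in> A. E y a})"
          using irr by (subst card_insert_disjoint) auto
        also have "\<dots> = 1 + (card {a \<in> A. a \<noteq> y \<and> \<not> E y a} + card {a \<in> A. E y a})"
          by (subst card_Un_disjoint) auto
        finally have cA: "card A = 1 + (card {a \<in> A. a \<noteq> y \<and> \<not> E y a} + card {a \<in> A. E y a})" .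
        have "{w \<in> W. E y w} = {a \<in> A. E y a} \<union> K" using AW irr by (auto simp: K_def U_def)
        then have "card {w \<in> W. E y w} = card {a \<in> A. E y a} + card K"
          using rem(2) by (simp add: card_Un_disjoint disjoint_iff)
        then show ?thesis using cA by simp
      qed
      moreover have "card {w \<in> W. E y w} \<le> deg E y" unfolding deg_def by (rule card_mono) auto
      moreover have "?\<alpha> * real (card A) \<le> ?\<alpha> * real (deg E v)"
        using card_mono[OF _ AN] kN \<alpha> by (intro mult_left_mono) auto
      \<comment> \<open>The edge is used in the order \<open>(y, v)\<close>: the degree of
        \<open>y\<close> counts fully, and that of \<open>v\<close> is weighted, as it bounds
        \<open>card A\<close>.\<close>
      ultimately have "real (card A + card K) \<le> D" using D[OF Ey] few by linarith
      then have qt: "real q + (real (card A + card K) - 1) \<le> t" by (rule budget[OF q(2) cU])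
      \<comment> \<open>The least \<open>r\<close> allowed by the vertex step: at least
        \<open>p\<close>, and with \<open>q + card K\<close> at most \<open>Suc r\<close>.\<close>
      define r where "r = max p (q + card K - 1)"
      have "R (Suc r) U"
        unfolding R_def
      proof (rule ideal_has_res_vertex_step[OF E _ Uy(2)])
        show "ideal_has_res r (ideal.span (edge_gens E (U - {y}) :: ('v, 'k) mpoly set))"
          using p(1) unfolding R_def Uy(1) by (rule ideal_has_res_mono) (simp add: r_def)
        show "ideal_has_res q (ideal.span (edge_gens E (U - insert y {v \<in> U. E y v}) :: ('v, 'k) mpoly set))"
          using q(1) unfolding R_def K_def .
        show "q + card {v \<in> U. E y v} \<le> Suc r" using K1 unfolding K_def[symmetric] r_def by linarith
      qed simp
      moreover have "real (Suc r) + real (card (A - {y})) \<le> t"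
      proof -
        have "card A \<ge> 1" using y card_mono[of A "{y}"] by simp
        then have "real (Suc r) + real (card (A - {y})) = real r + real (card A)"
          using y by (simp add: of_nat_diff)
        moreover have "real r + real (card A) \<le> t"
        proof (cases "p \<ge> q + card K - 1")
          case True
          then show ?thesis using p(2) by (simp add: r_def)
        next
          case False
          then have "real r = real q + real (card K) - 1" using K1 by (simp add: r_def of_nat_diff)
          then show ?thesis using qt by simp
        qed
        ultimately show ?thesis by simp
      qed
      ultimately have "T (A - {y})" using AN by (auto simp: T_def U_def)
      then show ?thesis using y by blast
    qed
    have "T N" using base by (simp add: T_def)
    then obtain A where A: "T A" "\<And>B. T B \<Longrightarrow> card A \<le> card B"
      using ex_has_least_nat[of T N card] by blast
    have "A = {}"
    proof (rule ccontr)
      assume "A \<noteq> {}"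
      then obtain y where y: "y \<in> A" "T (A - {y})" using step A(1) by blast
      then show False using A(2)[OF y(2)] card_Diff1_less[of A y] by simp
    qed
    then show ?thesis using A(1) by (simp add: T_def R_def t_def)
  qed
qed

theorem theorem3p6:
  fixes E :: "'v::finite \<Rightarrow> 'v \<Rightarrow> bool" and m :: nat and x y :: 'v
  assumes "simple_graph E"
    and "m \<ge> 1"
    and "\<not> has_induced_star E (m + 1)"
    and "alpha_max_edge ((real m - 1) / real m) E x y"
    and "deg E x \<ge> deg E y"
  shows "real (pd_graph E TYPE('k::field)) \<le>
    real (card (UNIV :: 'v set)) * (1 - 1 / (real (deg E x) + (real m - 1) / real m * real (deg E y) + 1))"
proof -
  define D where "D = real (deg E x) + (real m - 1) / real m * real (deg E y) + 1"
  have "D \<ge> 1" using assms(2) by (simp add: D_def)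
  moreover have "real (deg E u) + (real m - 1) / real m * real (deg E w) + 1 \<le> D" if "E u w" for u w
    using assms(4) that by (simp add: alpha_max_edge_def D_def)
  ultimately obtain p where p: "ideal_has_res p (ideal.span (edge_gens E UNIV :: ('v, 'k) mpoly set))"
      "real p \<le> real (card (UNIV :: 'v set)) * (1 - 1 / D)"
    using edge_ideal_res_bound[OF assms(1-3)] by blast
  from pd_graph_le[OF p(1)] have "real (pd_graph E TYPE('k)) \<le> real p" by simp
  then show ?thesis using p(2) unfolding D_def by linarith
qed

end
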